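(* Let $X$ and $Y$ be Banach spaces, let $\Delta\subset\mathbb{C}$ be a bounded open set, let $k_0\in\Delta$ and $r>0$ be such that $\Delta_0:=\{k\in\mathbb{C}: |k-k_0|\le r\}\subset\Delta$. For each $k\in\Delta$ let $A(k):X\to Y$ be a (possibly nonlinear) map and let $f(k)\in Y$. Assume: (a) for every $k\in\Delta_0$ the equation $A(k)u=g$ has a unique solution $u\in X$ for every $g\in Y$ (so that the inverse map $A^{-1}(k):Y\to X$ is defined); (b) $f$ is continuous on $\Delta_0$ and $\sup_{k\in\Delta_0}\|f(k)\|\le c_0$ for some constant $c_0<\infty$; (c) for every bounded set $M\subset X$, $$\lim_{h\to 0}\ \sup_{k,\,k+h\in\Delta_0,\ v\in M}\|A(k+h)v-A(k)v\|=0;$$ (d) for every bounded set $N\subset Y$ there is a constant $c_1=c_1(N)<\infty$ such that $$\sup_{k\in\Delta_0,\ g\in N}\|A^{-1}(k)g\|\le c_1 ;$$ (e) for every $k\in\Delta_0$ the map $A(k)$ is a homeomorphism of $X$ onto $Y$. For $k\in\Delta_0$ let $u(k)\in X$ be the unique solution of $A(k)u(k)=f(k)$. Then for every $k\in\Delta_0$, $$\lim_{h\to 0,\ k+h\in\Delta_0}\|u(k+h)-u(k)\|=0 .$$ *)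

theory Defs
  imports "HOL-Analysis.Analysis"
begin

end

theory Submission
  imports Defs
begin

text \<open>The set of all solutions \<^term>\<open>u k\<close> is bounded, so the equicontinuity hypothesis applies on it and
  \<^term>\<open>A k (u (k + h)) = f (k + h) - (A (k + h) (u (k + h)) - A k (u (k + h)))\<close> tends to \<^term>\<open>f k\<close>;
  applying the continuous inverse of \<^term>\<open>A k\<close> yields the claim.\<close>

text \<open>Bridge from the hypotheses, whose suprema are taken in \<open>ennreal\<close> so that a
  finite bound excludes unbounded families, to the predicate \<open>bounded\<close>.\<close>

lemma bounded_image_if_SUP_ennreal_norm_le:
  fixes f :: "'i \<Rightarrow> 'a::real_normed_vector"
  assumes "(SUP i\<in>I. ennreal (norm (f i))) \<le> ennreal c"
  shows "bounded (f ` I)"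
proof -
  \<comment> \<open>\<open>c\<close> may be negative; \<open>ennreal\<close> then truncates it to 0,
    hence the maximum.\<close>
  have "norm (f i) \<le> max 0 c" if "i \<in> I" for i
  proof -
    have "ennreal (norm (f i)) \<le> ennreal (max 0 c)"
      using SUP_upper[OF that, of "\<lambda>i. ennreal (norm (f i))"] assms
      by (metis ennreal_max_0 order_trans)
    then show ?thesis by simp
  qed
  then show ?thesis by (auto simp: bounded_iff)
qed

theorem theorem1p4:
  fixes A :: "complex \<Rightarrow> 'a::banach \<Rightarrow> 'b::banach"
    and f :: "complex \<Rightarrow> 'b"
    and u :: "complex \<Rightarrow> 'a"
    and \<Delta> \<Delta>\<^sub>0 :: "complex set"
    and k\<^sub>0 :: complex
    and r c\<^sub>0 :: real
  assumes "bounded \<Delta>" and "open \<Delta>" and "k\<^sub>0 \<in> \<Delta>" and "r > 0"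
    and \<Delta>\<^sub>0_eq: "\<Delta>\<^sub>0 = {k. norm (k - k\<^sub>0) \<le> r}" and "\<Delta>\<^sub>0 \<subseteq> \<Delta>"
    and a: "\<forall>k\<in>\<Delta>\<^sub>0. \<forall>g. \<exists>!v. A k v = g"
    and b_cont: "continuous_on \<Delta>\<^sub>0 f"
    and b_bound: "(SUP k\<in>\<Delta>\<^sub>0. ennreal (norm (f k))) \<le> ennreal c\<^sub>0"
    and c: "\<forall>M. bounded M \<longrightarrow>
          ((\<lambda>h. SUP (k, v)\<in>{(k, v). k \<in> \<Delta>\<^sub>0 \<and> k + h \<in> \<Delta>\<^sub>0 \<and> v \<in> M}.
                  ennreal (norm (A (k + h) v - A k v))) \<longlongrightarrow> 0) (at 0)"
    and d: "\<forall>N. bounded N \<longrightarrow>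
          (\<exists>c\<^sub>1::real. (SUP (k, g)\<in>\<Delta>\<^sub>0 \<times> N. ennreal (norm (inv (A k) g))) \<le> ennreal c\<^sub>1)"
    and e: "\<forall>k\<in>\<Delta>\<^sub>0. homeomorphism UNIV UNIV (A k) (inv (A k))"
    and u: "\<forall>k\<in>\<Delta>\<^sub>0. A k (u k) = f k"
  shows "\<forall>k\<in>\<Delta>\<^sub>0.
          ((\<lambda>h. norm (u (k + h) - u k)) \<longlongrightarrow> 0) (at 0 within {h. k + h \<in> \<Delta>\<^sub>0})"
proof
  fix k assume k: "k \<in> \<Delta>\<^sub>0"
  let ?F = "at 0 within {h. k + h \<in> \<Delta>\<^sub>0}"
  let ?D = "\<lambda>h. A (k + h) (u (k + h)) - A k (u (k + h))"
  have inv_A: "inv (A l) (A l v) = v" if "l \<in> \<Delta>\<^sub>0" for l v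
    using e that by (simp add: homeomorphism_def)
  have u_eq: "u l = inv (A l) (f l)" if "l \<in> \<Delta>\<^sub>0" for l
    using u inv_A that by metis
  have "bounded (u ` \<Delta>\<^sub>0)"
  proof -
    have "bounded (f ` \<Delta>\<^sub>0)"
      using b_bound by (rule bounded_image_if_SUP_ennreal_norm_le)
    then obtain c1 where
      "(SUP (l, g)\<in>\<Delta>\<^sub>0 \<times> f ` \<Delta>\<^sub>0. ennreal (norm (inv (A l) g))) \<le> ennreal c1"
      using d by blast
    \<comment> \<open>The bound covers all pairs \<open>(l, g)\<close>; the solutions are the values
      at the diagonal pairs \<open>(l, f l)\<close>.\<close>
    then have "bounded ((\<lambda>(l, g). inv (A l) g) ` (\<Delta>\<^sub>0 \<times> f ` \<Delta>\<^sub>0))"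
      by (intro bounded_image_if_SUP_ennreal_norm_le) (simp add: case_prod_unfold)
    then show ?thesis
      by (rule bounded_subset) (force simp: u_eq)
  qed
  then have S: "((\<lambda>h. SUP (l, v)\<in>{(l, v). l \<in> \<Delta>\<^sub>0 \<and> l + h \<in> \<Delta>\<^sub>0 \<and> v \<in> u ` \<Delta>\<^sub>0}.
      ennreal (norm (A (l + h) v - A l v))) \<longlongrightarrow> 0) ?F"
    using c by (blast intro: tendsto_within_subset)
  have "\<forall>\<^sub>F h in ?F. ennreal (norm (?D h)) \<le>
      (SUP (l, v)\<in>{(l, v). l \<in> \<Delta>\<^sub>0 \<and> l + h \<in> \<Delta>\<^sub>0 \<and> v \<in> u ` \<Delta>\<^sub>0}.
        ennreal (norm (A (l + h) v - A l v)))"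
    unfolding eventually_at_filter
    by (intro always_eventually allI impI SUP_upper2[where i = "(k, u (k + _))"]) (use k in auto)
  then have "((\<lambda>h. ennreal (norm (?D h))) \<longlongrightarrow> ennreal 0) ?F"
    using tendsto_sandwich[OF _ _ tendsto_const S] by simp
  then have "((\<lambda>h. norm (?D h)) \<longlongrightarrow> 0) ?F"
    by (subst (asm) tendsto_ennreal_iff) auto
  then have D: "(?D \<longlongrightarrow> 0) ?F"
    by (rule tendsto_norm_zero_cancel)
  have f_lim: "((\<lambda>h. f (k + h)) \<longlongrightarrow> f k) ?F"
  proof -
    \<comment> \<open>Continuity of the translate is evaluated at \<open>h = 0\<close>, which lies
      in this set because \<open>k\<close> is in \<open>\<Delta>\<^sub>0\<close>.\<close>
    have "continuous_on {h. k + h \<in> \<Delta>\<^sub>0} (\<lambda>h. f (k + h))"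
      by (rule continuous_on_compose2[OF b_cont]) (auto intro: continuous_intros)
    then show ?thesis
      using k unfolding continuous_on_def by (metis add_0_right mem_Collect_eq)
  qed
  have "((\<lambda>h. f (k + h) - ?D h) \<longlongrightarrow> f k) ?F"
    using tendsto_diff[OF f_lim D] by simp
  moreover have "isCont (inv (A k)) (f k)"
    using e k by (simp add: homeomorphism_def continuous_on_eq_continuous_at)
  ultimately have "((\<lambda>h. inv (A k) (f (k + h) - ?D h)) \<longlongrightarrow> u k) ?F"
    unfolding u_eq[OF k] by (rule isCont_tendsto_compose[rotated])
  then have "((\<lambda>h. u (k + h)) \<longlongrightarrow> u k) ?F"
  proof (rule Lim_transform_eventually)
    \<comment> \<open>As soon as \<open>k + h\<close> lies in \<open>\<Delta>\<^sub>0\<close>,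
      \<open>f (k + h)\<close> cancels \<open>A (k + h) (u (k + h))\<close>, and
      \<open>inv (A k)\<close> is applied to \<open>A k (u (k + h))\<close>.\<close>
    show "\<forall>\<^sub>F h in ?F. inv (A k) (f (k + h) - ?D h) = u (k + h)"
      using u inv_A[OF k] by (auto simp: eventually_at_filter)
  qed
  then show "((\<lambda>h. norm (u (k + h) - u k)) \<longlongrightarrow> 0) ?F"
    by (intro tendsto_norm_zero LIM_zero)
qed

end
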